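(* Let $N\ge1$ and $X=\{1,\dots,N\}$. A type $\mathcal M$ on $X$ is realizable if and only if it is admissible.
   Context: A shape is a multiset of nonnegative integers whose sum is at most $N$; for a shape $M$ and integer $x$, $\mu_M(x)$ is the number of entries of $M$ equal to $x$. A type is a multiset of shapes $\{M_1,\dots,M_k\}$; it is admissible if $\sum_{i=1}^k\mu_{M_i}(x)\le\binom{N}{x}$ for all $0\le x\le N$. For $\mathcal S\subseteq\mathcal P(X)$, a partial spread in $\mathcal S$ is a subset $\mathcal C\subseteq\mathcal S$ any two distinct members of which are disjoint; its shape is $\{|C|:C\in\mathcal C\}$. A disjoint partial spread system on $\mathcal S$ is a partition of $\mathcal S$ into partial spreads, and its type is the multiset of the shapes of its partial spreads. A type is realizable if it is the type of a disjoint partial spread system on some $\mathcal S\subseteq\mathcal P(X)$. *)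

theory Defs
  imports "HOL-Library.Multiset" "HOL-Library.Disjoint_Sets"
begin

definition is_shape :: "nat \<Rightarrow> nat multiset \<Rightarrow> bool" where
  "is_shape N M \<longleftrightarrow> sum_mset M \<le> N"

definition is_type :: "nat \<Rightarrow> nat multiset multiset \<Rightarrow> bool" where
  "is_type N T \<longleftrightarrow> (\<forall>M \<in># T. is_shape N M)"

definition admissible :: "nat \<Rightarrow> nat multiset multiset \<Rightarrow> bool" where
  "admissible N T \<longleftrightarrow> (\<forall>x\<le>N. (\<Sum>M\<in>#T. count M x) \<le> N choose x)"

definition partial_spread :: "'a set set \<Rightarrow> 'a set set \<Rightarrow> bool" where
  "partial_spread S C \<longleftrightarrow> C \<subseteq> S \<and> disjoint C"

definition spread_shape :: "'a set set \<Rightarrow> nat multiset" where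
  "spread_shape C = image_mset card (mset_set C)"

text \<open>
  The empty multiset is a shape, and a type may contain it repeatedly; it is the shape of the
  empty partial spread. A partition into partial spreads is therefore an indexed family
  \<open>C 0, \<dots>, C (k - 1)\<close> of pairwise disjoint, possibly empty, classes with union \<open>S\<close>.
  For types without empty shapes this is the same as an ordinary partition into nonempty
  classes: see \<open>realizable_iff_partition_on\<close> below.
\<close>

definition disjoint_partial_spread_system ::
  "'a set set \<Rightarrow> nat \<Rightarrow> (nat \<Rightarrow> 'a set set) \<Rightarrow> bool" where
  "disjoint_partial_spread_system S k C \<longleftrightarrow>
     (\<forall>i<k. partial_spread S (C i)) \<and>
     disjoint_family_on C {..<k} \<and> (\<Union>i<k. C i) = S"

definition system_type :: "nat \<Rightarrow> (nat \<Rightarrow> 'a set set) \<Rightarrow> nat multiset multiset" where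
  "system_type k C = image_mset (\<lambda>i. spread_shape (C i)) (mset_set {..<k})"

definition realizable :: "nat \<Rightarrow> nat multiset multiset \<Rightarrow> bool" where
  "realizable N T \<longleftrightarrow>
     (\<exists>S k C. S \<subseteq> Pow {1..N} \<and> disjoint_partial_spread_system S k C \<and> system_type k C = T)"

lemma realizable_iff_partition_on:
  assumes "{#} \<notin># T"
  shows "realizable N T \<longleftrightarrow>
    (\<exists>S P. S \<subseteq> Pow {1..N} \<and> partition_on S P \<and> (\<forall>C\<in>P. partial_spread S C) \<and>
           image_mset spread_shape (mset_set P) = T)"
proof
  assume "realizable N T"
  then obtain S k C where S: "S \<subseteq> Pow {1..N}"
    and sys: "disjoint_partial_spread_system S k C" and T: "system_type k C = T"
    unfolding realizable_def by blast
  have ne: "C i \<noteq> {}" if "i < k" for i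
  proof
    assume "C i = {}"
    hence "spread_shape (C i) = {#}" by (simp add: spread_shape_def)
    hence "{#} \<in># T" using that T by (force simp: system_type_def)
    thus False using assms by simp
  qed
  have dis: "C i \<inter> C j = {}" if "i < k" "j < k" "i \<noteq> j" for i j
    using sys that unfolding disjoint_partial_spread_system_def disjoint_family_on_def by auto
  have inj: "inj_on C {..<k}"
    using ne dis by (intro inj_onI) (metis Int_absorb lessThan_iff)
  have "partition_on S (C ` {..<k})"
  proof (rule partition_onI)
    show "\<Union> (C ` {..<k}) = S"
      using sys by (simp add: disjoint_partial_spread_system_def)
    show "{} \<notin> C ` {..<k}"
      using ne by (metis imageE lessThan_iff)
    show "disjnt p q" if "p \<in> C ` {..<k}" "q \<in> C ` {..<k}" "p \<noteq> q" for p q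
      using that dis unfolding disjnt_def by (metis imageE lessThan_iff)
  qed
  moreover have "\<forall>D\<in>C ` {..<k}. partial_spread S D"
    using sys unfolding disjoint_partial_spread_system_def by auto
  moreover have "image_mset spread_shape (mset_set (C ` {..<k})) = T"
    unfolding image_mset_mset_set[OF inj, symmetric] T[symmetric] system_type_def
    by (simp add: multiset.map_comp comp_def)
  ultimately show "\<exists>S P. S \<subseteq> Pow {1..N} \<and> partition_on S P \<and> (\<forall>C\<in>P. partial_spread S C) \<and>
           image_mset spread_shape (mset_set P) = T" using S by blast
next
  assume "\<exists>S P. S \<subseteq> Pow {1..N} \<and> partition_on S P \<and> (\<forall>C\<in>P. partial_spread S C) \<and>
           image_mset spread_shape (mset_set P) = T"
  then obtain S P where S: "S \<subseteq> Pow {1..N}" and P: "partition_on S P"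
    and sp: "\<forall>C\<in>P. partial_spread S C" and T: "image_mset spread_shape (mset_set P) = T" by blast
  have "finite S" using S by (rule finite_subset) simp
  hence "finite P" using P finite_elements by blast
  then obtain C where C: "bij_betw C {..<card P} P"
    using ex_bij_betw_nat_finite by (metis atLeast0LessThan)
  have img: "C ` {..<card P} = P" and inj: "inj_on C {..<card P}"
    using C by (auto simp: bij_betw_def)
  have "disjoint_family_on C {..<card P}"
    using P img inj unfolding partition_on_def disjoint_family_on_def disjoint_def
    by (metis image_eqI inj_on_eq_iff)
  moreover have "(\<Union>i<card P. C i) = S" using P img by (simp add: partition_on_def)
  moreover have "\<forall>i<card P. partial_spread S (C i)" using sp img by auto
  moreover have "system_type (card P) C = T"
  proof -
    have "mset_set P = image_mset C (mset_set {..<card P})"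
      using image_mset_mset_set[OF inj] by (simp only: img)
    thus ?thesis using T by (simp add: system_type_def multiset.map_comp comp_def)
  qed
  ultimately show "realizable N T"
    unfolding realizable_def disjoint_partial_spread_system_def using S by blast
qed

end

theory Submission
  imports Defs
begin

text \<open>
  Necessity is counting. For sufficiency, first pad the type so that every size \<open>x\<close> occurs
  exactly \<open>N choose x\<close> times. Then, as in proofs of Baranyai's theorem, the points
  \<open>1, \<dots>, N\<close> are distributed one at a time: the point \<open>l + 1\<close> goes to at most one entry of
  each shape, and the fractional solution giving an entry of size \<open>x\<close> with current set \<open>S\<close> the
  share \<open>(x - card S) / (N - l)\<close> of that point is rounded to an integral one by Hall's theorem.
\<close>

section \<open>Hall's marriage theorem\<close>

definition hall_condition :: "'i set \<Rightarrow> ('i \<Rightarrow> 'a set) \<Rightarrow> bool" where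
  "hall_condition I A \<longleftrightarrow> (\<forall>J\<subseteq>I. card J \<le> card (\<Union>(A ` J)))"

text \<open>Rado's argument: if both deletions destroyed Hall's condition, submodularity of the size
  of unions would merge the two violations into one of the original family.\<close>

lemma hall_condition_shrink:
  assumes "finite I" and fin: "\<And>i. i \<in> I \<Longrightarrow> finite (A i)" and hall: "hall_condition I A"
    and i: "i \<in> I" and xy: "x \<in> A i" "y \<in> A i" "x \<noteq> y"
  shows "hall_condition I (A(i := A i - {x})) \<or> hall_condition I (A(i := A i - {y}))"
proof (rule ccontr)
  \<comment> \<open>Only \<open>A i\<close> shrinks, so a violating family must contain
    \<open>i\<close>. Dropping \<open>i\<close> from it turns the strict deficit into a weak
    one.\<close>
  have viol: "\<exists>J. J \<subseteq> I \<and> i \<notin> J \<and> card (\<Union>(A ` J) \<union> (A i - {z})) \<le> card J"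
    if nh: "\<not> hall_condition I (A(i := A i - {z}))" for z
  proof -
    obtain J where J: "J \<subseteq> I" and lt: "card (\<Union>((A(i := A i - {z})) ` J)) < card J"
      using nh unfolding hall_condition_def by (auto simp: not_le)
    have "i \<in> J"
    proof (rule ccontr)
      assume "i \<notin> J"
      then have "(A(i := A i - {z})) ` J = A ` J" by auto
      then show False using lt hall J unfolding hall_condition_def by (metis not_le)
    qed
    have "\<Union>((A(i := A i - {z})) ` J) = \<Union>(A ` (J - {i})) \<union> (A i - {z})"
      using \<open>i \<in> J\<close> by auto
    moreover have "card J = Suc (card (J - {i}))"
      using \<open>i \<in> J\<close> J \<open>finite I\<close> by (metis card.remove finite_subset)
    ultimately show ?thesis using lt J by (intro exI[of _ "J - {i}"]) auto
  qed
  assume "\<not> ?thesis"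
  then obtain J K where J: "J \<subseteq> I" "i \<notin> J" and K: "K \<subseteq> I" "i \<notin> K"
    and cJ: "card (\<Union>(A ` J) \<union> (A i - {x})) \<le> card J"
    and cK: "card (\<Union>(A ` K) \<union> (A i - {y})) \<le> card K"
    using viol by meson
  let ?P = "\<Union>(A ` J) \<union> (A i - {x})" and ?Q = "\<Union>(A ` K) \<union> (A i - {y})"
  have finJK: "finite J" "finite K" using J K \<open>finite I\<close> by (auto intro: finite_subset)
  have finPQ: "finite ?P" "finite ?Q" using J K finJK fin i by auto
  \<comment> \<open>As \<open>x\<close> and \<open>y\<close> differ, \<open>?P \<union> ?Q\<close>
    still contains all of \<open>A i\<close>, so Hall's condition for
    \<open>insert i (J \<union> K)\<close> gains one from \<open>i\<close>. Hall's condition for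
    \<open>J \<inter> K\<close> bounds \<open>?P \<inter> ?Q\<close> from below. Added up,
    \<open>card ?P + card ?Q\<close> exceeds \<open>card J + card K\<close>, against
    \<open>cJ\<close> and \<open>cK\<close>.\<close>
  have "card (insert i (J \<union> K)) \<le> card (\<Union>(A ` insert i (J \<union> K)))"
    using hall i J K unfolding hall_condition_def
    by (elim allE[of _ "insert i (J \<union> K)"] impE) auto
  also have "\<dots> \<le> card (?P \<union> ?Q)"
    using finPQ xy by (intro card_mono) auto
  finally have 1: "Suc (card (J \<union> K)) \<le> card (?P \<union> ?Q)" using J K finJK by simp
  have "card (J \<inter> K) \<le> card (\<Union>(A ` (J \<inter> K)))"
    using hall J unfolding hall_condition_def by (metis Int_lower1 order_trans)
  also have "\<dots> \<le> card (?P \<inter> ?Q)" using finPQ by (intro card_mono) auto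
  finally have 2: "card (J \<inter> K) \<le> card (?P \<inter> ?Q)" .
  show False
    using 1 2 cJ cK card_Un_Int[OF finPQ] card_Un_Int[OF finJK] by linarith
qed

text \<open>Deleting elements while Hall's condition survives ends with sets of at most one element.
  The condition for single indices makes these nonempty, and for pairs of indices it makes them
  distinct.\<close>

theorem hall_marriage:
  assumes "finite I" and "\<And>i. i \<in> I \<Longrightarrow> finite (A i)" and "hall_condition I A"
  shows "\<exists>f. inj_on f I \<and> (\<forall>i\<in>I. f i \<in> A i)"
  using assms
proof (induction "\<Sum>i\<in>I. card (A i)" arbitrary: A rule: less_induct)
  case less
  show ?case
  proof (cases "\<exists>i\<in>I. \<exists>x\<in>A i. \<exists>y\<in>A i. x \<noteq> y")
    case True
    then obtain i x y where i: "i \<in> I" and xy: "x \<in> A i" "y \<in> A i" "x \<noteq> y" by blast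
    then obtain z where z: "z \<in> A i" and hz: "hall_condition I (A(i := A i - {z}))"
      using hall_condition_shrink[OF less.prems i xy] by blast
    let ?B = "A(i := A i - {z})"
    have "(\<Sum>j\<in>I. card (?B j)) < (\<Sum>j\<in>I. card (A j))"
    proof (rule sum_strict_mono_ex1)
      show "\<forall>j\<in>I. card (?B j) \<le> card (A j)"
        using less.prems(2) by (auto intro: card_mono)
      show "\<exists>j\<in>I. card (?B j) < card (A j)"
        using i z less.prems(2)[OF i]
        by (intro bexI[of _ i]) (auto intro: card_Diff1_less simp del: card_Diff_insert)
    qed (rule less.prems)
    moreover have "finite (?B j)" if "j \<in> I" for j using less.prems(2) i that by simp
    ultimately obtain f where "inj_on f I" "\<forall>j\<in>I. f j \<in> ?B j"
      using less.hyps[of ?B] less.prems(1) hz by blast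
    then show ?thesis by (intro exI[of _ f]) (auto split: if_splits)
  next
    case False
    have ne: "A i \<noteq> {}" if "i \<in> I" for i
      using less.prems(3) that unfolding hall_condition_def
      by (auto dest: spec[of _ "{i}"])
    define f where "f i = (SOME x. x \<in> A i)" for i
    have f: "A i = {f i}" if "i \<in> I" for i
    proof -
      have "f i \<in> A i" unfolding f_def using ne[OF that] by (metis some_in_eq)
      then show ?thesis using False that by blast
    qed
    have "inj_on f I"
    proof (rule inj_onI, rule ccontr)
      fix i j assume ij: "i \<in> I" "j \<in> I" "f i = f j" "i \<noteq> j"
      then have "card {i, j} \<le> card (\<Union>(A ` {i, j}))"
        using less.prems(3) unfolding hall_condition_def by (metis empty_subsetI insert_subset)
      then show False using ij f by simp
    qed
    then show ?thesis using f by auto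
  qed
qed

section \<open>Rounding fractional assignments\<close>

text \<open>Replacing each \<open>r\<close> by \<open>c r\<close> copies of itself turns \<open>w\<close> into a regular bipartite
  multigraph, for which Hall's condition follows by counting edges.\<close>

lemma regular_weight_assignment:
  fixes w :: "'i \<Rightarrow> 'r \<Rightarrow> nat"
  assumes fin: "finite I" "finite R" and "n > 0"
    and row: "\<And>i. i \<in> I \<Longrightarrow> (\<Sum>r\<in>R. w i r) = n"
    and col: "\<And>r. r \<in> R \<Longrightarrow> (\<Sum>i\<in>I. w i r) = n * c r"
  shows "\<exists>\<phi>. (\<forall>i\<in>I. \<phi> i \<in> R \<and> w i (\<phi> i) > 0) \<and> (\<forall>r\<in>R. card {i\<in>I. \<phi> i = r} = c r)"
proof -
  define B where "B = (SIGMA r:R. {..<c r})"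
  define A where "A i = (SIGMA r:{r\<in>R. w i r > 0}. {..<c r})" for i
  have "finite B" unfolding B_def using fin by auto
  have AB: "A i \<subseteq> B" for i unfolding A_def B_def by auto
  have cardB: "card B = (\<Sum>r\<in>R. c r)" unfolding B_def using fin by simp
  have "hall_condition I A"
    unfolding hall_condition_def
  proof (intro allI impI)
    fix J assume J: "J \<subseteq> I"
    then have "finite J" using fin finite_subset by blast
    define Q where "Q = {r\<in>R. \<exists>i\<in>J. w i r > 0}"
    have "Q \<subseteq> R" "finite Q" unfolding Q_def using fin by auto
    have "n * card J = (\<Sum>i\<in>J. \<Sum>r\<in>R. w i r)" using row J by (simp add: subset_iff)
    also have "\<dots> = (\<Sum>i\<in>J. \<Sum>r\<in>Q. w i r)"
      by (intro sum.cong refl sum.mono_neutral_right) (auto simp: Q_def fin)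
    also have "\<dots> = (\<Sum>r\<in>Q. \<Sum>i\<in>J. w i r)" by (rule sum.swap)
    also have "\<dots> \<le> (\<Sum>r\<in>Q. \<Sum>i\<in>I. w i r)"
      using J fin by (intro sum_mono sum_mono2) auto
    also have "\<dots> = (\<Sum>r\<in>Q. n * c r)"
      using col \<open>Q \<subseteq> R\<close> by (intro sum.cong) auto
    also have "\<dots> = n * card (SIGMA r:Q. {..<c r})"
      using \<open>finite Q\<close> by (simp add: sum_distrib_left)
    also have "(SIGMA r:Q. {..<c r}) = \<Union>(A ` J)" unfolding Q_def A_def by auto
    finally show "card J \<le> card (\<Union>(A ` J))" using \<open>n > 0\<close> by simp
  qed
  moreover have "finite (A i)" for i using AB \<open>finite B\<close> by (rule finite_subset)
  ultimately obtain f where inj: "inj_on f I" and f: "\<And>i. i \<in> I \<Longrightarrow> f i \<in> A i"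
    using hall_marriage[OF fin(1), of A] by blast
  \<comment> \<open>The total weight, computed by rows and by columns, shows that there are as many
    copies as rows. The injection \<open>f\<close> therefore uses every copy, and each
    \<open>r\<close> is chosen exactly \<open>c r\<close> times.\<close>
  have "n * card I = (\<Sum>i\<in>I. \<Sum>r\<in>R. w i r)" using row by simp
  also have "\<dots> = (\<Sum>r\<in>R. \<Sum>i\<in>I. w i r)" by (rule sum.swap)
  also have "\<dots> = n * card B" using col by (simp add: cardB sum_distrib_left)
  finally have "card I = card B" using \<open>n > 0\<close> by simp
  moreover have "f ` I \<subseteq> B" using f AB by blast
  ultimately have surj: "f ` I = B"
    using inj \<open>finite B\<close> by (intro card_subset_eq) (auto simp: card_image)
  have "card {i\<in>I. fst (f i) = r} = c r" if "r \<in> R" for r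
  proof -
    have "card {i\<in>I. fst (f i) = r} = card (f ` {i\<in>I. fst (f i) = r})"
      using inj by (intro card_image[symmetric]) (auto intro: inj_on_subset)
    also have "f ` {i\<in>I. fst (f i) = r} = {p\<in>B. fst p = r}" using surj by auto
    also have "\<dots> = {r} \<times> {..<c r}" unfolding B_def using that by auto
    finally show ?thesis by simp
  qed
  moreover have "fst (f i) \<in> R \<and> w i (fst (f i)) > 0" if "i \<in> I" for i
    using f[OF that] unfolding A_def by auto
  ultimately show ?thesis by (intro exI[of _ "\<lambda>i. fst (f i)"]) auto
qed

text \<open>An extra column \<open>None\<close> absorbs the slack of each row and reduces this to
  the regular case. A row can choose \<open>None\<close> only if its slack is positive, hence the
  strict inequality in the conclusion.\<close>

lemma subregular_weight_assignment:
  fixes w :: "'i \<Rightarrow> 'r \<Rightarrow> nat"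
  assumes fin: "finite I" "finite R" and n: "n > 0"
    and row: "\<And>i. i \<in> I \<Longrightarrow> (\<Sum>r\<in>R. w i r) \<le> n"
    and col: "\<And>r. r \<in> R \<Longrightarrow> (\<Sum>i\<in>I. w i r) = n * c r"
  shows "\<exists>\<phi>. (\<forall>i\<in>I. case \<phi> i of None \<Rightarrow> (\<Sum>r\<in>R. w i r) < n | Some r \<Rightarrow> r \<in> R \<and> w i r > 0) \<and>
             (\<forall>r\<in>R. card {i\<in>I. \<phi> i = Some r} = c r)"
proof -
  define v where "v i p = (case p of None \<Rightarrow> n - (\<Sum>r\<in>R. w i r) | Some r \<Rightarrow> w i r)" for i p
  \<comment> \<open>The quota of \<open>None\<close> is forced by double counting: the slacks sum to
    \<open>n * card I\<close> minus \<open>n\<close> times the sum of all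
    \<open>c r\<close>.\<close>
  define d where "d p = (case p of None \<Rightarrow> card I - (\<Sum>r\<in>R. c r) | Some r \<Rightarrow> c r)" for p
  let ?R = "insert None (Some ` R)"
  have "(\<Sum>i\<in>I. \<Sum>r\<in>R. w i r) = (\<Sum>r\<in>R. \<Sum>i\<in>I. w i r)" by (rule sum.swap)
  also have "\<dots> = n * (\<Sum>r\<in>R. c r)" using col by (simp add: sum_distrib_left)
  finally have tot: "(\<Sum>i\<in>I. \<Sum>r\<in>R. w i r) = n * (\<Sum>r\<in>R. c r)" .
  have "\<exists>\<phi>. (\<forall>i\<in>I. \<phi> i \<in> ?R \<and> v i (\<phi> i) > 0) \<and> (\<forall>p\<in>?R. card {i\<in>I. \<phi> i = p} = d p)"
  proof (rule regular_weight_assignment[OF _ _ n])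
    show "(\<Sum>p\<in>?R. v i p) = n" if "i \<in> I" for i
      using fin row[OF that] by (simp add: v_def sum.reindex)
    show "(\<Sum>i\<in>I. v i p) = n * d p" if "p \<in> ?R" for p
    proof (cases p)
      case None
      have "(\<Sum>i\<in>I. v i None) = (\<Sum>i\<in>I. n) - (\<Sum>i\<in>I. \<Sum>r\<in>R. w i r)"
        unfolding v_def option.case using row by (intro sum_subtractf_nat) auto
      then show ?thesis using None tot by (simp add: d_def diff_mult_distrib2 mult.commute)
    next
      case (Some r)
      then show ?thesis using that col by (auto simp: v_def d_def)
    qed
  qed (use fin in auto)
  then obtain \<phi> where "\<forall>i\<in>I. \<phi> i \<in> ?R \<and> v i (\<phi> i) > 0"
    and "\<forall>p\<in>?R. card {i\<in>I. \<phi> i = p} = d p" by blast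
  then show ?thesis
    by (intro exI[of _ \<phi>]) (auto simp: v_def d_def split: option.split dest!: bspec)
qed

section \<open>Distributing the points one at a time\<close>

text \<open>\<open>A e\<close> is the trace on \<open>{1..l}\<close> of the set to be assigned to \<open>e\<close>. The last condition
  says that \<open>S\<close> occurs as a trace as often as there are \<open>x\<close>-subsets of \<open>{1..N}\<close> meeting
  \<open>{1..l}\<close> in \<open>S\<close>; at \<open>l = N\<close> it forces the sets to be distinct.\<close>

definition partial_realization ::
    "nat \<Rightarrow> 'e set \<Rightarrow> ('e \<Rightarrow> 'i) \<Rightarrow> ('e \<Rightarrow> nat) \<Rightarrow> nat \<Rightarrow> ('e \<Rightarrow> nat set) \<Rightarrow> bool" where
  "partial_realization N E a sz l A \<longleftrightarrow>
     (\<forall>e\<in>E. A e \<subseteq> {1..l} \<and> card (A e) \<le> sz e) \<and>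
     (\<forall>e\<in>E. \<forall>f\<in>E. e \<noteq> f \<longrightarrow> a e = a f \<longrightarrow> A e \<inter> A f = {}) \<and>
     (\<forall>i. (\<Sum>e | e \<in> E \<and> a e = i. sz e - card (A e)) \<le> N - l) \<and>
     (\<forall>x\<le>N. \<forall>S\<subseteq>{1..l}. card S \<le> x \<longrightarrow>
        card {e\<in>E. sz e = x \<and> A e = S} = (N - l) choose (x - card S))"

text \<open>The fractional shares of the point \<open>Suc l\<close> are scaled by
  \<open>n = N - l\<close> to become integers. Rows are the indices, columns the pairs of a size and
  a current trace. The bound on missing sizes bounds the row sums, and the trace counts make the
  column sums multiples of \<open>n\<close>. Rounding then selects at most one column for each
  index.\<close>

lemma partial_realization_Suc:
  assumes finE: "finite E" and sz: "\<And>e. e \<in> E \<Longrightarrow> sz e \<le> N" and l: "l < N"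
    and pr: "partial_realization N E a sz l A"
  shows "\<exists>A'. partial_realization N E a sz (Suc l) A'"
proof -
  define n where "n = N - l"
  obtain m where m: "n = Suc m" "N - Suc l = m"
    using l unfolding n_def by (metis Suc_diff_Suc)
  have A: "A e \<subseteq> {1..l}" "card (A e) \<le> sz e" if "e \<in> E" for e
    using pr that unfolding partial_realization_def by auto
  have finA: "finite (A e)" "Suc l \<notin> A e" if "e \<in> E" for e
    using A[OF that] by (auto intro: finite_subset)
  have dis: "A e \<inter> A f = {}" if "e \<in> E" "f \<in> E" "e \<noteq> f" "a e = a f" for e f
    using pr that unfolding partial_realization_def by auto
  have rem: "(\<Sum>e | e \<in> E \<and> a e = i. sz e - card (A e)) \<le> n" for i
    using pr unfolding partial_realization_def n_def by auto
  have cnt: "card {e\<in>E. sz e = x \<and> A e = S} = n choose (x - card S)"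
    if "x \<le> N" "S \<subseteq> {1..l}" "card S \<le> x" for x S
    using pr that unfolding partial_realization_def n_def by blast
  define I where "I = a ` E"
  define R where "R = {(x, S). x \<le> N \<and> S \<subseteq> {1..l} \<and> card S \<le> x}"
  define w where "w i r = (\<Sum>e | e \<in> E \<and> a e = i \<and> (sz e, A e) = r. sz e - card (A e))" for i r
  \<comment> \<open>The number of \<open>x\<close>-subsets of \<open>{1..N}\<close> that meet
    \<open>{1..l}\<close> in \<open>S\<close> and contain \<open>Suc l\<close>. For
    \<open>card S = x\<close> it must be 0, while truncated subtraction would give
    \<open>m choose 0 = 1\<close>.\<close>
  define c where "c = (\<lambda>(x, S :: nat set). if card S < x then m choose (x - card S - 1) else 0)"
  have "finite I" unfolding I_def using finE by simp
  have "R \<subseteq> {..N} \<times> Pow {1..l}" unfolding R_def by auto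
  then have "finite R" by (rule finite_subset) simp
  have inR: "(sz e, A e) \<in> R" if "e \<in> E" for e using that A sz unfolding R_def by auto
  have row: "(\<Sum>r\<in>R. w i r) = (\<Sum>e | e \<in> E \<and> a e = i. sz e - card (A e))" for i
  proof -
    have "(\<Sum>r\<in>R. w i r) =
        (\<Sum>r\<in>R. \<Sum>e\<in>{e \<in> {e\<in>E. a e = i}. (sz e, A e) = r}. sz e - card (A e))"
      unfolding w_def by (intro sum.cong) auto
    also have "\<dots> = (\<Sum>e | e \<in> E \<and> a e = i. sz e - card (A e))"
      using finE \<open>finite R\<close> inR by (intro sum.group) auto
    finally show ?thesis .
  qed
  have col: "(\<Sum>i\<in>I. w i r) = n * c r" if "r \<in> R" for r
  proof -
    obtain x S where r: "r = (x, S)" by fastforce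
    have "(\<Sum>i\<in>I. w i r) =
        (\<Sum>i\<in>I. \<Sum>e\<in>{e \<in> {e\<in>E. (sz e, A e) = r}. a e = i}. sz e - card (A e))"
      unfolding w_def by (intro sum.cong) auto
    also have "\<dots> = (\<Sum>e | e \<in> E \<and> (sz e, A e) = r. sz e - card (A e))"
      using finE \<open>finite I\<close> by (intro sum.group) (auto simp: I_def)
    also have "\<dots> = card {e\<in>E. sz e = x \<and> A e = S} * (x - card S)"
      unfolding r by simp
    also have "\<dots> = (n choose (x - card S)) * (x - card S)"
      using that r cnt unfolding R_def by auto
    \<comment> \<open>The absorption identity:
      \<open>k * (n choose k) = n * (n - 1 choose k - 1)\<close> for positive
      \<open>k\<close>.\<close>
    also have "\<dots> = n * c r"
    proof (cases "card S < x")
      case True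
      then obtain k where "x - card S = Suc k" by (metis Suc_diff_Suc)
      then show ?thesis using True r Suc_times_binomial_eq[of m k] by (simp add: c_def m)
    next
      case False
      then show ?thesis using r by (simp add: c_def)
    qed
    finally show ?thesis .
  qed
  obtain \<phi> where \<phi>: "\<And>i. i \<in> I \<Longrightarrow>
        case \<phi> i of None \<Rightarrow> (\<Sum>r\<in>R. w i r) < n | Some r \<Rightarrow> r \<in> R \<and> w i r > 0"
    and card\<phi>: "\<And>r. r \<in> R \<Longrightarrow> card {i\<in>I. \<phi> i = Some r} = c r"
  proof -
    have "\<exists>\<phi>. (\<forall>i\<in>I. case \<phi> i of None \<Rightarrow> (\<Sum>r\<in>R. w i r) < n | Some r \<Rightarrow> r \<in> R \<and> w i r > 0) \<and>
               (\<forall>r\<in>R. card {i\<in>I. \<phi> i = Some r} = c r)"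
      using \<open>finite I\<close> \<open>finite R\<close> row rem col m(1)
      by (intro subregular_weight_assignment) auto
    then show ?thesis using that by blast
  qed
  \<comment> \<open>Positive weight means that index \<open>i\<close> has an incomplete entry in the
    class \<open>r\<close>, so that entry has room for the new point.\<close>
  have ex: "\<exists>e. e \<in> E \<and> a e = i \<and> (sz e, A e) = r \<and> card (A e) < sz e"
    if "i \<in> I" "\<phi> i = Some r" for i r
  proof (rule ccontr)
    assume "\<not> ?thesis"
    then have "w i r = 0" unfolding w_def by (auto simp: not_less)
    then show False using \<phi>[OF that(1)] that(2) by simp
  qed
  obtain g where g: "\<And>i r. i \<in> I \<Longrightarrow> \<phi> i = Some r \<Longrightarrow>
      g i \<in> E \<and> a (g i) = i \<and> (sz (g i), A (g i)) = r \<and> card (A (g i)) < sz (g i)"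
  proof -
    have "\<forall>i. \<exists>e. \<forall>r. i \<in> I \<longrightarrow> \<phi> i = Some r \<longrightarrow>
        e \<in> E \<and> a e = i \<and> (sz e, A e) = r \<and> card (A e) < sz e"
      using ex by (metis option.inject)
    then show ?thesis using that by (metis (no_types, lifting))
  qed
  \<comment> \<open>The entries that receive \<open>Suc l\<close>. Since \<open>g\<close> picks one
    entry per index, no two entries with the same index receive it, which preserves
    disjointness.\<close>
  define F where "F = g ` {i\<in>I. \<phi> i \<noteq> None}"
  have F: "e \<in> E \<and> card (A e) < sz e \<and> g (a e) = e \<and> \<phi> (a e) = Some (sz e, A e)"
    if "e \<in> F" for e
    using that g unfolding F_def by fastforce
  have cardF: "card {e\<in>F. (sz e, A e) = r} = c r" if "r \<in> R" for r
  proof -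
    have "{e\<in>F. (sz e, A e) = r} = g ` {i\<in>I. \<phi> i = Some r}"
      using g unfolding F_def by fastforce
    moreover have "inj_on g {i\<in>I. \<phi> i = Some r}"
      using g by (intro inj_onI) (metis (mono_tags, lifting) mem_Collect_eq)
    ultimately show ?thesis using card\<phi>[OF that] by (simp add: card_image)
  qed
  define A' where "A' e = (if e \<in> F then insert (Suc l) (A e) else A e)" for e
  have cardA': "card (A' e) = (if e \<in> F then Suc (card (A e)) else card (A e))" if "e \<in> E" for e
    using finA[OF that] unfolding A'_def by simp
  have "partial_realization N E a sz (Suc l) A'"
    unfolding partial_realization_def m
  proof (intro conjI ballI allI impI)
    fix e assume e: "e \<in> E"
    show "A' e \<subseteq> {1..Suc l}" using A[OF e] unfolding A'_def by auto
    show "card (A' e) \<le> sz e" using A[OF e] F[of e] cardA'[OF e] by auto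
  next
    fix e f assume ef: "e \<in> E" "f \<in> E" "e \<noteq> f" "a e = a f"
    then have "\<not> (e \<in> F \<and> f \<in> F)" using F by metis
    then show "A' e \<inter> A' f = {}"
      using dis[OF ef] finA ef unfolding A'_def by auto
  next
    fix i
    let ?E = "{e\<in>E. a e = i}"
    have le: "sz e - card (A' e) \<le> sz e - card (A e)" if "e \<in> ?E" for e
      using that cardA'[of e] by auto
    \<comment> \<open>Either some entry of index \<open>i\<close> receives the point and the missing
      total drops, or \<open>\<phi> i = None\<close> and the row sum was already below
      \<open>n\<close>. An index without entries has nothing missing.\<close>
    have "(\<Sum>e\<in>?E. sz e - card (A' e)) < n"
    proof (cases "\<exists>e\<in>?E. e \<in> F")
      case True
      then obtain e where e: "e \<in> ?E" "e \<in> F" by blast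
      have "(\<Sum>e\<in>?E. sz e - card (A' e)) < (\<Sum>e\<in>?E. sz e - card (A e))"
        using finE le e F[of e] cardA'[of e]
        by (intro sum_strict_mono_ex1) (auto intro!: bexI[of _ e])
      then show ?thesis using rem[of i] by simp
    next
      case False
      have le': "(\<Sum>e\<in>?E. sz e - card (A' e)) \<le> (\<Sum>e\<in>?E. sz e - card (A e))"
        using le by (rule sum_mono)
      show ?thesis
      proof (cases "i \<in> I")
        case True
        have "\<phi> i = None"
        proof (rule ccontr)
          assume "\<phi> i \<noteq> None"
          then have "g i \<in> F" "g i \<in> ?E" using True g unfolding F_def by auto
          then show False using False by blast
        qed
        then show ?thesis using \<phi>[OF True] row[of i] le' by simp
      next
        case False
        then have "?E = {}" unfolding I_def by auto
        then show ?thesis using m by (simp only: sum.empty)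
      qed
    qed
    then show "(\<Sum>e\<in>?E. sz e - card (A' e)) \<le> m" using m by simp
  next
    fix x S assume x: "x \<le> N" and S: "S \<subseteq> {1..Suc l}" "card S \<le> x"
    have finS: "finite S" using S finite_subset by blast
    have "F \<subseteq> E" using F by blast
    then have "finite F" using finE by (rule finite_subset)
    show "card {e\<in>E. sz e = x \<and> A' e = S} = m choose (x - card S)"
    proof (cases "Suc l \<in> S")
      case True
      define S0 where "S0 = S - {Suc l}"
      have S0: "S = insert (Suc l) S0" "Suc l \<notin> S0" "card S = Suc (card S0)"
        using True finS unfolding S0_def by (auto simp del: card_Diff_insert simp: card_Suc_Diff1)
      have "S0 \<subseteq> {1..l}" using S(1) unfolding S0_def by (auto simp: le_Suc_eq)
      then have r: "(x, S0) \<in> R" using x S(2) S0(3) unfolding R_def by simp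
      \<comment> \<open>No old trace contains \<open>Suc l\<close>, so only the entries in
        \<open>F\<close> can now have a trace containing it.\<close>
      have "{e\<in>E. sz e = x \<and> A' e = S} = {e\<in>F. (sz e, A e) = (x, S0)}"
      proof (intro Collect_cong iffI)
        fix e assume e: "e \<in> E \<and> sz e = x \<and> A' e = S"
        then have "e \<in> F" using S0 finA(2)[of e] unfolding A'_def by (auto split: if_splits)
        then show "e \<in> F \<and> (sz e, A e) = (x, S0)"
          using e S0 finA(2)[of e] insert_ident[of "Suc l" "A e" S0] unfolding A'_def by auto
      next
        fix e assume "e \<in> F \<and> (sz e, A e) = (x, S0)"
        then show "e \<in> E \<and> sz e = x \<and> A' e = S" using F[of e] S0 unfolding A'_def by auto
      qed
      then show ?thesis using cardF[OF r] S S0 by (simp add: c_def)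
    next
      case False
      have "S \<subseteq> {1..l}" using S False by (auto simp: le_Suc_eq)
      then have r: "(x, S) \<in> R" using x S unfolding R_def by auto
      have "{e\<in>E. sz e = x \<and> A' e = S} = {e\<in>E. sz e = x \<and> A e = S} - {e\<in>F. (sz e, A e) = (x, S)}"
        using False unfolding A'_def by auto
      also have "card \<dots> = card {e\<in>E. sz e = x \<and> A e = S} - c (x, S)"
        using \<open>finite F\<close> F by (subst card_Diff_subset) (auto simp: cardF[OF r, simplified])
      also have "\<dots> = (n choose (x - card S)) - c (x, S)"
        using cnt x S \<open>S \<subseteq> {1..l}\<close> by simp
      \<comment> \<open>Pascal's rule: the \<open>x\<close>-sets with trace \<open>S\<close> split
        by whether they contain \<open>Suc l\<close>, and those containing it have just been
        removed.\<close>
      also have "\<dots> = m choose (x - card S)"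
      proof (cases "card S < x")
        case True
        then obtain k where "x - card S = Suc k" by (metis Suc_diff_Suc)
        then show ?thesis using True m by (simp add: c_def)
      qed (use S in \<open>simp add: c_def\<close>)
      finally show ?thesis .
    qed
  qed
  then show ?thesis by blast
qed

section \<open>Assigning distinct sets to entries of prescribed sizes\<close>

lemma exact_sizes_realizable:
  fixes a :: "'e \<Rightarrow> 'i" and sz :: "'e \<Rightarrow> nat"
  assumes finE: "finite E"
    and sum: "\<And>i. (\<Sum>e | e \<in> E \<and> a e = i. sz e) \<le> N"
    and cnt: "\<And>x. x \<le> N \<Longrightarrow> card {e\<in>E. sz e = x} = N choose x"
  shows "\<exists>A. inj_on A E \<and> (\<forall>e\<in>E. A e \<subseteq> {1..N} \<and> card (A e) = sz e) \<and>
             (\<forall>e\<in>E. \<forall>f\<in>E. e \<noteq> f \<longrightarrow> a e = a f \<longrightarrow> A e \<inter> A f = {})"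
proof -
  \<comment> \<open>The counts \<open>cnt\<close> concern only sizes up to \<open>N\<close>; the sum
    bounds exclude larger ones.\<close>
  have sz: "sz e \<le> N" if "e \<in> E" for e
  proof -
    have "sz e \<le> (\<Sum>f | f \<in> E \<and> a f = a e. sz f)"
      using that finE by (intro member_le_sum) auto
    then show ?thesis using sum[of "a e"] by simp
  qed
  have "\<exists>A. partial_realization N E a sz l A" if "l \<le> N" for l
    using that
  proof (induction l)
    case 0
    show ?case
      using sum cnt by (intro exI[of _ "\<lambda>_. {}"]) (auto simp: partial_realization_def)
  next
    case (Suc l)
    then show ?case using partial_realization_Suc[of E sz N l a] finE sz by auto
  qed
  then obtain A where pr: "partial_realization N E a sz N A" by blast
  have A: "A e \<subseteq> {1..N}" "card (A e) \<le> sz e" if "e \<in> E" for e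
    using pr that unfolding partial_realization_def by auto
  \<comment> \<open>With no points left, the binomial is 0 if \<open>A e\<close> is incomplete,
    impossible as \<open>e\<close> itself is counted, and 1 if it is complete. The former gives
    \<open>card_eq\<close>, the latter injectivity.\<close>
  have cls: "card {f\<in>E. sz f = sz e \<and> A f = A e} = 0 choose (sz e - card (A e))" if "e \<in> E" for e
    using pr that A[OF that] sz[OF that] unfolding partial_realization_def by auto
  have card_eq: "card (A e) = sz e" if "e \<in> E" for e
  proof (rule ccontr)
    assume "card (A e) \<noteq> sz e"
    then have "card {f\<in>E. sz f = sz e \<and> A f = A e} = 0" using cls[OF that] A(2)[OF that] by simp
    then show False using finE that by auto
  qed
  have "inj_on A E"
  proof (rule inj_onI)
    fix e f assume ef: "e \<in> E" "f \<in> E" "A e = A f"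
    have "card {h\<in>E. sz h = sz e \<and> A h = A e} = 1"
      using cls[OF ef(1)] card_eq[OF ef(1)] by simp
    then obtain h where h: "{h\<in>E. sz h = sz e \<and> A h = A e} = {h}"
      by (rule card_1_singletonE)
    have "sz f = sz e" using card_eq ef by metis
    then have "e \<in> {h}" "f \<in> {h}" unfolding h[symmetric] using ef by auto
    then show "e = f" by simp
  qed
  then show ?thesis
    using A card_eq pr unfolding partial_realization_def by (intro exI[of _ A]) auto
qed

text \<open>Each missing occurrence of a size \<open>x\<close> is added as an entry with an index of
  its own. Such a one-entry shape has sum \<open>x\<close>, at most \<open>N\<close>, and the
  original entries keep their indices, so restricting the exact solution suffices.\<close>

lemma bounded_sizes_realizable:
  fixes a :: "'e \<Rightarrow> 'i" and sz :: "'e \<Rightarrow> nat"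
  assumes finE: "finite E"
    and sum: "\<And>i. (\<Sum>e | e \<in> E \<and> a e = i. sz e) \<le> N"
    and cnt: "\<And>x. x \<le> N \<Longrightarrow> card {e\<in>E. sz e = x} \<le> N choose x"
  shows "\<exists>A. inj_on A E \<and> (\<forall>e\<in>E. A e \<subseteq> {1..N} \<and> card (A e) = sz e) \<and>
             (\<forall>e\<in>E. \<forall>f\<in>E. e \<noteq> f \<longrightarrow> a e = a f \<longrightarrow> A e \<inter> A f = {})"
proof -
  define P where "P = (SIGMA x:{..N}. {..<(N choose x) - card {e\<in>E. sz e = x}})"
  define E' where "E' = E <+> P"
  define a' where "a' = map_sum a (\<lambda>p :: nat \<times> nat. p)"
  define sz' where "sz' = case_sum sz (\<lambda>p :: nat \<times> nat. fst p)"
  have "finite P" unfolding P_def by simp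
  have "\<exists>A. inj_on A E' \<and> (\<forall>e\<in>E'. A e \<subseteq> {1..N} \<and> card (A e) = sz' e) \<and>
             (\<forall>e\<in>E'. \<forall>f\<in>E'. e \<noteq> f \<longrightarrow> a' e = a' f \<longrightarrow> A e \<inter> A f = {})"
  proof (rule exact_sizes_realizable)
    show "finite E'" unfolding E'_def using finE \<open>finite P\<close> by simp
    show "(\<Sum>e | e \<in> E' \<and> a' e = i. sz' e) \<le> N" for i
    proof (cases i)
      case (Inl j)
      then have "{e\<in>E'. a' e = i} = Inl ` {e\<in>E. a e = j}"
        unfolding E'_def a'_def by auto
      then show ?thesis using sum[of j] by (simp add: sum.reindex sz'_def)
    next
      case (Inr p)
      then have "{e\<in>E'. a' e = i} = Inr ` {q\<in>P. q = p}"
        unfolding E'_def a'_def by auto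
      also have "{q\<in>P. q = p} = (if p \<in> P then {p} else {})" by auto
      finally show ?thesis by (auto simp: sz'_def P_def)
    qed
    show "card {e\<in>E'. sz' e = x} = N choose x" if "x \<le> N" for x
    proof -
      have "{e\<in>E'. sz' e = x} =
          {e\<in>E. sz e = x} <+> ({x} \<times> {..<(N choose x) - card {e\<in>E. sz e = x}})"
        unfolding E'_def sz'_def P_def using that by auto
      then show ?thesis using cnt[OF that] finE by (simp add: card_Plus)
    qed
  qed
  then obtain A where inj: "inj_on A E'"
    and A: "\<forall>e\<in>E'. A e \<subseteq> {1..N} \<and> card (A e) = sz' e"
    and dis: "\<forall>e\<in>E'. \<forall>f\<in>E'. e \<noteq> f \<longrightarrow> a' e = a' f \<longrightarrow> A e \<inter> A f = {}" by blast
  have in': "Inl e \<in> E'" if "e \<in> E" for e using that unfolding E'_def by auto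
  have "inj_on (\<lambda>e. A (Inl e)) E"
    using inj in' by (auto simp: inj_on_def)
  moreover have "\<forall>e\<in>E. A (Inl e) \<subseteq> {1..N} \<and> card (A (Inl e)) = sz e"
    using A in' by (fastforce simp: sz'_def)
  moreover have "\<forall>e\<in>E. \<forall>f\<in>E. e \<noteq> f \<longrightarrow> a e = a f \<longrightarrow> A (Inl e) \<inter> A (Inl f) = {}"
    using dis in' by (simp add: a'_def)
  ultimately show ?thesis by blast
qed

section \<open>Necessity by counting\<close>

lemma count_spread_shape:
  assumes "finite C"
  shows "count (spread_shape C) x = card {c\<in>C. card c = x}"
proof -
  have "count (spread_shape C) x = size (filter_mset (\<lambda>c. card c = x) (mset_set C))"
    unfolding spread_shape_def by (simp add: count_conv_size_mset filter_mset_image_mset eq_commute)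
  then show ?thesis using assms by simp
qed

lemma realizable_imp_admissible:
  assumes "realizable N T"
  shows "admissible N T"
  unfolding admissible_def
proof (intro allI impI)
  fix x assume "x \<le> N"
  obtain S k C where S: "S \<subseteq> Pow {1..N}" and C: "disjoint_partial_spread_system S k C"
    and T: "system_type k C = T"
    using assms unfolding realizable_def by blast
  have "finite S" using S by (rule finite_subset) simp
  have CS: "C i \<subseteq> S" if "i < k" for i
    using C that unfolding disjoint_partial_spread_system_def by blast
  then have finC: "finite (C i)" if "i < k" for i
    using that \<open>finite S\<close> finite_subset by blast
  have "(\<Sum>M\<in>#T. count M x) = (\<Sum>i<k. count (spread_shape (C i)) x)"
    unfolding T[symmetric] system_type_def
    by (simp add: multiset.map_comp comp_def sum_unfold_sum_mset)
  also have "\<dots> = (\<Sum>i<k. card {c\<in>C i. card c = x})"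
    using finC by (simp add: count_spread_shape)
  \<comment> \<open>The classes of a system are disjoint, so no set is counted under two
    indices.\<close>
  also have "\<dots> = card (\<Union>i<k. {c\<in>C i. card c = x})"
    using C finC unfolding disjoint_partial_spread_system_def disjoint_family_on_def
    by (intro card_UN_disjoint[symmetric]) fastforce+
  also have "\<dots> \<le> card {c. c \<subseteq> {1..N} \<and> card c = x}"
    using CS S by (intro card_mono) (auto intro: finite_subset[of _ "Pow {1..N}"])
  also have "\<dots> = N choose x" by (simp add: n_subsets)
  finally show "(\<Sum>M\<in>#T. count M x) \<le> N choose x" .
qed

section \<open>Sufficiency: from assigned sets to a system of partial spreads\<close>

lemma admissible_imp_realizable:
  assumes type: "is_type N T" and adm: "admissible N T"
  shows "realizable N T"
proof -
  obtain Ms where Ms: "mset Ms = T" using ex_mset by blast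
  define k where "k = length Ms"
  have "\<forall>i. \<exists>xs. mset xs = Ms ! i" using ex_mset by blast
  then obtain L where L: "\<And>i. mset (L i) = Ms ! i" by metis
  \<comment> \<open>Entries are positions \<open>(i, j)\<close> in lists, so repeated shapes and
    repeated sizes stay distinct. An empty shape has no positions but keeps its index, and its class
    will be empty.\<close>
  define E where "E = (SIGMA i:{..<k}. {..<length (L i)})"
  define sz where "sz = (\<lambda>(i, j). L i ! j)"
  have T: "T = image_mset (\<lambda>i. Ms ! i) (mset_set {..<k})"
  proof -
    have "T = mset (map (\<lambda>i. Ms ! i) [0..<k])" unfolding Ms[symmetric] k_def map_nth ..
    then show ?thesis by (simp add: atLeast0LessThan)
  qed
  have "finite E" unfolding E_def by simp
  have entries: "{e\<in>E. fst e = i} = Pair i ` {..<length (L i)}" if "i < k" for i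
    using that unfolding E_def by auto
  have "\<exists>A. inj_on A E \<and> (\<forall>e\<in>E. A e \<subseteq> {1..N} \<and> card (A e) = sz e) \<and>
             (\<forall>e\<in>E. \<forall>f\<in>E. e \<noteq> f \<longrightarrow> fst e = fst f \<longrightarrow> A e \<inter> A f = {})"
  proof (rule bounded_sizes_realizable[OF \<open>finite E\<close>])
    show "(\<Sum>e | e \<in> E \<and> fst e = i. sz e) \<le> N" for i
    proof (cases "i < k")
      case True
      have "(\<Sum>e | e \<in> E \<and> fst e = i. sz e) = (\<Sum>j<length (L i). L i ! j)"
        unfolding entries[OF True] by (simp add: sum.reindex inj_on_def sz_def)
      also have "\<dots> = sum_mset (Ms ! i)"
        using sum_mset_sum_list[of "L i"] by (simp add: L sum_list_sum_nth atLeast0LessThan)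
      also have "\<dots> \<le> N"
        using type True Ms unfolding is_type_def is_shape_def k_def by auto
      finally show ?thesis .
    next
      case False
      then have "{e\<in>E. fst e = i} = {}" unfolding E_def by auto
      then show ?thesis by (simp only: sum.empty)
    qed
    show "card {e\<in>E. sz e = x} \<le> N choose x" if "x \<le> N" for x
    proof -
      have "{e\<in>E. sz e = x} = (SIGMA i:{..<k}. {j. j < length (L i) \<and> L i ! j = x})"
        unfolding E_def sz_def by auto
      then have "card {e\<in>E. sz e = x} = (\<Sum>i<k. card {j. j < length (L i) \<and> L i ! j = x})"
        by simp
      also have "\<dots> = (\<Sum>i<k. count (Ms ! i) x)"
        by (simp add: L[symmetric] count_mset length_filter_conv_card eq_commute
            count_list_eq_length_filter)
      also have "\<dots> = (\<Sum>M\<in>#T. count M x)"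
        unfolding T by (simp add: multiset.map_comp comp_def sum_unfold_sum_mset)
      finally show ?thesis using adm that unfolding admissible_def by simp
    qed
  qed
  then obtain A where inj: "inj_on A E"
    and A: "\<And>e. e \<in> E \<Longrightarrow> A e \<subseteq> {1..N} \<and> card (A e) = sz e"
    and dis: "\<And>e f. e \<in> E \<Longrightarrow> f \<in> E \<Longrightarrow> e \<noteq> f \<Longrightarrow> fst e = fst f \<Longrightarrow> A e \<inter> A f = {}"
    by metis
  define C where "C i = A ` {e\<in>E. fst e = i}" for i
  have shape: "spread_shape (C i) = Ms ! i" if "i < k" for i
  proof -
    \<comment> \<open>Injectivity ensures that passing from entries to the set \<open>C i\<close>
      loses no multiplicities.\<close>
    have "inj_on A {e\<in>E. fst e = i}" using inj by (rule inj_on_subset) auto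
    then have "spread_shape (C i) = image_mset (\<lambda>e. card (A e)) (mset_set {e\<in>E. fst e = i})"
      unfolding spread_shape_def C_def
      by (simp add: image_mset_mset_set[symmetric] multiset.map_comp comp_def)
    also have "\<dots> = image_mset sz (mset_set {e\<in>E. fst e = i})"
      using A \<open>finite E\<close> by (intro image_mset_cong) auto
    also have "\<dots> = image_mset (\<lambda>j. L i ! j) (mset_set {..<length (L i)})"
      unfolding entries[OF that]
      by (simp add: image_mset_mset_set[symmetric] inj_on_def multiset.map_comp comp_def sz_def)
    also have "\<dots> = mset (map (\<lambda>j. L i ! j) [0..<length (L i)])"
      by (simp add: atLeast0LessThan)
    also have "\<dots> = Ms ! i" by (simp only: map_nth L)
    finally show ?thesis .
  qed
  have "disjoint_partial_spread_system (A ` E) k C"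
    unfolding disjoint_partial_spread_system_def partial_spread_def
  proof (intro conjI allI impI)
    show "C i \<subseteq> A ` E" for i unfolding C_def by auto
    show "disjoint (C i)" for i
      unfolding disjoint_def C_def using dis by fastforce
    \<comment> \<open>Injectivity across different indices: no set is assigned to entries of two
      shapes.\<close>
    show "disjoint_family_on C {..<k}"
      using inj unfolding disjoint_family_on_def C_def by (auto simp: inj_on_def)
    show "(\<Union>i<k. C i) = A ` E" unfolding C_def E_def by auto
  qed
  moreover have "system_type k C = T"
    unfolding system_type_def T using shape by (intro image_mset_cong) auto
  moreover have "A ` E \<subseteq> Pow {1..N}" using A by auto
  ultimately show ?thesis unfolding realizable_def by blast
qed

theorem theorem2p4:
  fixes N :: nat and T :: "nat multiset multiset"
  assumes "N \<ge> 1" and "is_type N T"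
  shows "realizable N T \<longleftrightarrow> admissible N T"
  using realizable_imp_admissible admissible_imp_realizable[OF assms(2)] by blast

end
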